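(* The set $\xi_3\subset\mathbb{R}^2$ of possible pairs $(\lambda_2,\lambda_3)$ of non-trivial eigenvalues of $3\times3$ monotone matrices, ordered so that $\lambda_2\ge\lambda_3$, is the region of the $(\lambda_2,\lambda_3)$-plane (boundary included) bounded by the following curves, which together form a closed curve: \begin{itemize} \item $C_1$: $\lambda_2=\lambda_3$ for $0\le\lambda_2\le1$; \item $C_2$: $\lambda_2=-\lambda_3$ for $0\le\lambda_2\le\frac12$; \item $C_3$: $\lambda_2=1$ for $0\le\lambda_3\le1$; \item $C_4$: $\lambda_2\lambda_3=-\frac14$ for $\frac12\le\lambda_2\le\frac{1+\sqrt5}{4}$; \item $C_5$: $\lambda_2^2+\lambda_2\lambda_3+\lambda_3^2-\lambda_2-\lambda_3=0$ for $\frac{1+\sqrt5}{4}\le\lambda_2\le1$ and $\lambda_3\le0$. \end{itemize}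
   Context: A stochastic matrix is a (real) entrywise non-negative square matrix each of whose row sums equals $1$. An $n\times n$ monotone matrix is an $n\times n$ stochastic matrix $M=(m_{ij})$ such that $\sum_{j=r}^n m_{lj}\ge\sum_{j=r}^n m_{kj}$ for all $l>k$ in $\{1,\dots,n\}$ and all $r\in\{1,\dots,n\}$. Let $\mathcal{M}_3$ be the set of $3\times3$ monotone matrices. The spectrum of every $M\in\mathcal{M}_3$ is real and contains $1$. Writing $\sigma(M)$ for the spectrum of $M$, with eigenvalues counted with algebraic multiplicity, define $$\xi_3:=\{(\lambda_2,\lambda_3)\in\mathbb{R}^2 : \exists M\in\mathcal{M}_3 \text{ with } \sigma(M)=\{1,\lambda_2,\lambda_3\}\text{ and }\lambda_2\ge\lambda_3\}.$$ *)

theory Defs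
  imports
    "HOL-Analysis.Analysis"
    "Jordan_Normal_Form.Char_Poly"
begin

text \<open>Rows and columns of matrices are indexed from 0, so the index set \<open>{1,\<dots>,n}\<close> becomes \<open>{0..<n}\<close>.\<close>

definition stochastic_matrix :: "nat \<Rightarrow> real mat \<Rightarrow> bool" where
  "stochastic_matrix n M \<longleftrightarrow>
     M \<in> carrier_mat n n \<and>
     (\<forall>i<n. \<forall>j<n. 0 \<le> M $$ (i, j)) \<and>
     (\<forall>i<n. (\<Sum>j = 0..<n. M $$ (i, j)) = 1)"

definition monotone_matrix :: "nat \<Rightarrow> real mat \<Rightarrow> bool" where
  "monotone_matrix n M \<longleftrightarrow>
     stochastic_matrix n M \<and>
     (\<forall>l<n. \<forall>k<l. \<forall>r<n.
        (\<Sum>j = r..<n. M $$ (l, j)) \<ge> (\<Sum>j = r..<n. M $$ (k, j)))"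

definition monotone_matrices :: "nat \<Rightarrow> real mat set" where
  "monotone_matrices n = {M. monotone_matrix n M}"

text \<open>The multiset of all complex eigenvalues: \<open>proots\<close> counts each root of the
  characteristic polynomial with its multiplicity.\<close>

definition eigenvalue_mset :: "real mat \<Rightarrow> complex multiset" where
  "eigenvalue_mset M = proots (char_poly (map_mat complex_of_real M))"

definition xi3 :: "(real \<times> real) set" where
  "xi3 = {(x, y). \<exists>M \<in> monotone_matrices 3.
            eigenvalue_mset M = {# 1, complex_of_real x, complex_of_real y #} \<and> x \<ge> y}"

text \<open>In a pair \<open>(x, y)\<close> below, \<open>x\<close> stands for \<open>\<lambda>\<^sub>2\<close> and \<open>y\<close> for \<open>\<lambda>\<^sub>3\<close>.\<close>

definition C1 :: "(real \<times> real) set" where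
  "C1 = {(x, y). x = y \<and> 0 \<le> x \<and> x \<le> 1}"

definition C2 :: "(real \<times> real) set" where
  "C2 = {(x, y). x = - y \<and> 0 \<le> x \<and> x \<le> 1/2}"

definition C3 :: "(real \<times> real) set" where
  "C3 = {(x, y). x = 1 \<and> 0 \<le> y \<and> y \<le> 1}"

definition C4 :: "(real \<times> real) set" where
  "C4 = {(x, y). x * y = - (1/4) \<and> 1/2 \<le> x \<and> x \<le> (1 + sqrt 5) / 4}"

definition C5 :: "(real \<times> real) set" where
  "C5 = {(x, y). x\<^sup>2 + x * y + y\<^sup>2 - x - y = 0 \<and> (1 + sqrt 5) / 4 \<le> x \<and> x \<le> 1 \<and> y \<le> 0}"

definition boundary_curve :: "(real \<times> real) set" where
  "boundary_curve = C1 \<union> C2 \<union> C3 \<union> C4 \<union> C5"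

end

theory Submission
  imports Defs
begin

text \<open>
  Passing to tail sums turns a $3\times 3$ monotone matrix into a block triangular matrix with blocks
  1 and a nonnegative matrix $((a, b), (c, d))$, whose entries are the increments of the tail sums
  from row to row. The matrices that arise are exactly those with $a + c$, $b + d$, $b + c \le 1$,
  so $\xi_3$ is described by the possible traces and determinants. The determinant is at
  least $-1/4$ because $b + c \le 1$ (this gives $C_4$), and when the trace $t$ lies in
  $[1/2, 1]$ it is at least $-t(1 - t)$ (this gives $C_5$). Negative determinants are realised with $d = 0$.

  The region lies between the graph of a continuous function and the diagonal. Its interior is open and
  closed in the complement of the curve, and every point outside the region sees infinity along a
  horizontal or vertical ray, which determines the inside of the curve without the Jordan curve theorem.
\<close>

section \<open>The inside of the edge of a region between two graphs\<close>

lemma continuous_on_fst_snd_comp: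
  fixes f :: "real \<Rightarrow> real"
  assumes "continuous_on {a..b} f" "S \<subseteq> {a..b} \<times> UNIV"
  shows "continuous_on S (\<lambda>p. f (fst p) - snd p)"
  by (intro continuous_intros continuous_on_compose2[OF assms(1)]) (use assms(2) in auto)

lemma inside_region_between_graphs:
  fixes f g :: "real \<Rightarrow> real"
  assumes f: "continuous_on {a..b} f" and g: "continuous_on {a..b} g"
    and le: "\<And>x. x \<in> {a..b} \<Longrightarrow> f x \<le> g x"
    and B: "B = {(x, y). x \<in> {a..b} \<and> f x \<le> y \<and> y \<le> g x} -
                {(x, y). x \<in> {a<..<b} \<and> f x < y \<and> y < g x}"
  shows "inside B = {(x, y). x \<in> {a<..<b} \<and> f x < y \<and> y < g x}"
proof -
  define R where "R = {(x, y). x \<in> {a..b} \<and> f x \<le> y \<and> y \<le> g x}"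
  define U where "U = {(x, y). x \<in> {a<..<b} \<and> f x < y \<and> y < g x}"
  have BRU: "B = R - U" and "U \<subseteq> R"
    unfolding B R_def U_def by auto
  have "open U"
  proof -
    have sub: "{a<..<b} \<times> (UNIV :: real set) \<subseteq> {a..b} \<times> UNIV"
      by auto
    have op: "open ({a<..<b} \<times> (UNIV :: real set))"
      by (intro open_Times) auto
    have "U = (({a<..<b} \<times> UNIV) \<inter> (\<lambda>p. f (fst p) - snd p) -` {..<0}) \<inter>
              (({a<..<b} \<times> UNIV) \<inter> (\<lambda>p. g (fst p) - snd p) -` {0<..})"
      unfolding U_def by auto
    then show ?thesis
      by (simp only:) (intro open_Int continuous_open_preimage continuous_on_fst_snd_comp[OF f sub]
        continuous_on_fst_snd_comp[OF g sub] op open_lessThan open_greaterThan)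
  qed
  have "closed R"
  proof -
    have cl: "closed ({a..b} \<times> (UNIV :: real set))"
      by (intro closed_Times) auto
    have "R = (({a..b} \<times> UNIV) \<inter> (\<lambda>p. f (fst p) - snd p) -` {..0}) \<inter>
              (({a..b} \<times> UNIV) \<inter> (\<lambda>p. g (fst p) - snd p) -` {0..})"
      unfolding R_def by auto
    then show ?thesis
      by (simp only:) (intro closed_Int continuous_closed_preimage continuous_on_fst_snd_comp[OF f order_refl]
        continuous_on_fst_snd_comp[OF g order_refl] cl closed_atMost closed_atLeast)
  qed
  have "bounded R"
  proof -
    have "bounded (f ` {a..b})" "bounded (g ` {a..b})"
      using f g by (auto intro!: compact_imp_bounded compact_continuous_image)
    then obtain m n where m: "\<And>x. x \<in> {a..b} \<Longrightarrow> \<bar>f x\<bar> \<le> m" and n: "\<And>x. x \<in> {a..b} \<Longrightarrow> \<bar>g x\<bar> \<le> n"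
      unfolding bounded_iff real_norm_def by blast
    have "R \<subseteq> {a..b} \<times> {-m..n}"
    proof clarify
      fix x y assume "(x, y) \<in> R"
      with m[of x] n[of x] show "x \<in> {a..b} \<and> y \<in> {-m..n}"
        by (auto simp: R_def)
    qed
    then show ?thesis
      by (rule bounded_subset[rotated]) (intro bounded_Times bounded_closed_interval)
  qed
  \<comment> \<open>\<open>- B\<close> is covered by the disjoint open sets \<open>U\<close> and
    \<open>- R\<close>, so a component that meets \<open>U\<close> cannot leave it.\<close>
  have in_U: "connected_component_set (- B) p \<subseteq> U" if "p \<in> U" for p
  proof -
    let ?C = "connected_component_set (- B) p"
    have "?C \<subseteq> - B"
      by (rule connected_component_subset)
    then have cov: "?C \<subseteq> U \<union> - R"
      using BRU by auto
    have "p \<in> ?C"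
      using that BRU by (auto intro: connected_component_refl)
    moreover have "U \<inter> ?C = {} \<or> - R \<inter> ?C = {}"
      using connectedD[OF connected_connected_component \<open>open U\<close> open_Compl[OF \<open>closed R\<close>] _ cov] \<open>U \<subseteq> R\<close>
      by blast
    ultimately show ?thesis
      using that cov by blast
  qed
  have out: "\<not> bounded (connected_component_set (- B) p)" if p: "p \<notin> R" for p
  proof -
    obtain x y where xy: "p = (x, y)"
      by force
    \<comment> \<open>A ray from \<open>p\<close> that misses \<open>R\<close> is a connected
      unbounded subset of \<open>- B\<close>.\<close>
    have ray: "\<not> bounded (connected_component_set (- B) p)"
      if "v \<noteq> 0" and "\<And>t. 0 \<le> t \<Longrightarrow> p + t *\<^sub>R v \<notin> R" for v
    proof -
      let ?S = "(\<lambda>t. p + t *\<^sub>R v) ` {0..}"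
      have "?S \<subseteq> connected_component_set (- B) p"
      proof (rule connected_component_maximal)
        show "p \<in> ?S"
          by (auto intro!: image_eqI[of _ _ 0])
        show "connected ?S"
          by (intro connected_continuous_image continuous_intros) auto
        show "?S \<subseteq> - B"
          using that BRU by auto
      qed
      moreover have "\<not> bounded ?S"
      proof
        assume "bounded ?S"
        then obtain K where K: "\<And>t. t \<ge> 0 \<Longrightarrow> norm (p + t *\<^sub>R v) \<le> K"
          unfolding bounded_iff by auto
        have K0: "K \<ge> 0"
          using K[of 0] norm_ge_zero[of p] by (simp del: norm_ge_zero)
        \<comment> \<open>This \<open>t\<close> makes the displacement \<open>t *\<^sub>R v\<close>
          longer by 1 than the bound \<open>K + norm p\<close> allows.\<close>
        define t where "t = (K + norm p + 1) / norm v"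
        have t0: "t \<ge> 0"
          using K0 by (simp add: t_def)
        have "norm (t *\<^sub>R v) \<le> norm (p + t *\<^sub>R v) + norm p"
          using norm_triangle_ineq4[of "p + t *\<^sub>R v" p] by simp
        moreover have "norm (t *\<^sub>R v) = K + norm p + 1"
          using t0 \<open>v \<noteq> 0\<close> K0 by (simp add: t_def)
        ultimately show False
          using K[OF t0] by simp
      qed
      ultimately show ?thesis
        using bounded_subset by blast
    qed
    consider "x < a" | "x > b" | "x \<in> {a..b}" "y < f x" | "x \<in> {a..b}" "y > g x"
      using p unfolding xy R_def by force
    then show ?thesis
    proof cases
      case 1
      then show ?thesis
        by (intro ray[of "(-1, 0)"]) (auto simp: xy R_def zero_prod_def)
    next
      case 2
      then show ?thesis
        by (intro ray[of "(1, 0)"]) (auto simp: xy R_def zero_prod_def)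
    next
      case 3
      then show ?thesis
        by (intro ray[of "(0, -1)"]) (auto simp: xy R_def zero_prod_def)
    next
      case 4
      then show ?thesis
        by (intro ray[of "(0, 1)"]) (auto simp: xy R_def zero_prod_def)
    qed
  qed
  have "inside B = U"
  proof (intro equalityI subsetI)
    fix p assume "p \<in> inside B"
    then show "p \<in> U"
      using out[of p] BRU by (auto simp: inside_def)
  next
    fix p assume "p \<in> U"
    then show "p \<in> inside B"
      using in_U[of p] bounded_subset[OF \<open>bounded R\<close>] \<open>U \<subseteq> R\<close> BRU
      by (auto simp: inside_def)
  qed
  then show ?thesis
    unfolding U_def .
qed

lemma arc_graph:
  fixes f :: "real \<Rightarrow> real"
  assumes "continuous_on {0..1} f"
  shows "arc (\<lambda>t. (t, f t))"
  using assms unfolding arc_def path_def by (auto intro!: continuous_intros inj_onI)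

subsection \<open>The boundary curve\<close>

text \<open>The smaller root in \<open>y\<close> of the equation of \<open>C\<^sub>5\<close>.\<close>

definition conic_branch :: "real \<Rightarrow> real" where
  "conic_branch x = ((1 - x) - sqrt ((1 - x) * (1 + 3 * x))) / 2"

text \<open>The arcs \<open>C2\<close>, \<open>C4\<close> and \<open>C5\<close> joined end to end as
  one graph over \<open>{0..1}\<close>.\<close>

definition lower_boundary :: "real \<Rightarrow> real" where
  "lower_boundary x =
     (if x \<le> 1/2 then - x else if x \<le> (1 + sqrt 5) / 4 then - 1 / (4 * x) else conic_branch x)"

lemma corner_bounds: "1/2 < (1 + sqrt 5) / 4" "(1 + sqrt 5) / 4 < 1"
  by (auto intro!: real_less_lsqrt real_less_rsqrt)

text \<open>The corner is the positive root of \<open>x^2 - x/2 - 1/4\<close>, which arises by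
  putting \<open>y = 1/2 - x\<close> into \<open>x * y = - 1/4\<close>. So \<open>C4\<close> and
  \<open>C5\<close> meet on the line \<open>x + y = 1/2\<close>.\<close>

lemma corner_sq: "((1 + sqrt 5) / 4)\<^sup>2 = (1 + sqrt 5) / 8 + 1 / 4"
  by (simp add: power2_eq_square field_simps)

lemma corner_le_iff:
  assumes "1/2 \<le> x"
  shows "(1 + sqrt 5) / 4 \<le> x \<longleftrightarrow> 0 \<le> x\<^sup>2 - x / 2 - 1 / 4"
proof -
  let ?\<rho> = "(1 + sqrt 5) / 4"
  have "x\<^sup>2 - x / 2 - 1 / 4 = (x - ?\<rho>) * (x + ?\<rho> - 1/2)"
    using corner_sq by (simp add: power2_eq_square algebra_simps)
  moreover have "0 < x + ?\<rho> - 1/2"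
    using assms corner_bounds by linarith
  ultimately show ?thesis
    by (simp add: zero_le_mult_iff)
qed

text \<open>Completing the square in \<open>y\<close>: \<open>D\<close> is the discriminant of
  \<open>q\<close> viewed as a quadratic in \<open>y\<close>.\<close>

lemma square_discriminant_iff:
  fixes x y :: real
  defines "D \<equiv> (1 - x) * (1 + 3 * x)" and "q \<equiv> x\<^sup>2 + x * y + y\<^sup>2 - x - y"
  shows "((1 - x) - 2 * y)\<^sup>2 \<le> D \<longleftrightarrow> q \<le> 0"
    and "((1 - x) - 2 * y)\<^sup>2 = D \<longleftrightarrow> q = 0"
proof -
  have "((1 - x) - 2 * y)\<^sup>2 = D + 4 * q"
    unfolding D_def q_def by (simp add: power2_eq_square algebra_simps)
  then show "((1 - x) - 2 * y)\<^sup>2 \<le> D \<longleftrightarrow> q \<le> 0" "((1 - x) - 2 * y)\<^sup>2 = D \<longleftrightarrow> q = 0"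
    by auto
qed

text \<open>For \<open>y \<le> 0\<close> only the smaller root matters, as the larger one is
  nonnegative. In the proof this is the sign of \<open>(1 - x) - 2 * y\<close>, which permits
  squaring.\<close>

lemma conic_branch_le_iff:
  assumes "0 \<le> x" "x \<le> 1" "y \<le> 0"
  shows "conic_branch x \<le> y \<longleftrightarrow> x\<^sup>2 + x * y + y\<^sup>2 - x - y \<le> 0"
proof -
  let ?D = "(1 - x) * (1 + 3 * x)"
  have D: "0 \<le> ?D"
    using assms by (intro mult_nonneg_nonneg) auto
  have nn: "0 \<le> (1 - x) - 2 * y"
    using assms by linarith
  have "conic_branch x \<le> y \<longleftrightarrow> (1 - x) - 2 * y \<le> sqrt ?D"
    unfolding conic_branch_def by (auto simp: field_simps)
  also have "\<dots> \<longleftrightarrow> ((1 - x) - 2 * y)\<^sup>2 \<le> ?D"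
    using nn D by (metis real_le_rsqrt real_sqrt_le_iff real_sqrt_pow2 power_mono)
  also have "\<dots> \<longleftrightarrow> x\<^sup>2 + x * y + y\<^sup>2 - x - y \<le> 0"
    by (rule square_discriminant_iff)
  finally show ?thesis .
qed

lemma conic_branch_nonpos:
  assumes "0 \<le> x" "x \<le> 1"
  shows "conic_branch x \<le> 0"
proof -
  have "x * x \<le> x"
    using assms mult_left_le by blast
  then show ?thesis
    using assms by (subst conic_branch_le_iff) (auto simp: power2_eq_square)
qed

lemma conic_branch_eq_iff:
  assumes "0 \<le> x" "x \<le> 1" "y \<le> 0"
  shows "y = conic_branch x \<longleftrightarrow> x\<^sup>2 + x * y + y\<^sup>2 - x - y = 0"
proof -
  let ?D = "(1 - x) * (1 + 3 * x)"
  have D: "0 \<le> ?D"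
    using assms by (intro mult_nonneg_nonneg) auto
  have nn: "0 \<le> (1 - x) - 2 * y"
    using assms by linarith
  have "y = conic_branch x \<longleftrightarrow> (1 - x) - 2 * y = sqrt ?D"
    unfolding conic_branch_def by (auto simp: field_simps)
  also have "\<dots> \<longleftrightarrow> ((1 - x) - 2 * y)\<^sup>2 = ?D"
    using nn D by (metis real_sqrt_abs abs_of_nonneg real_sqrt_pow2)
  also have "\<dots> \<longleftrightarrow> x\<^sup>2 + x * y + y\<^sup>2 - x - y = 0"
    by (rule square_discriminant_iff)
  finally show ?thesis .
qed


text \<open>Both sides equal \<open>1/2 - r\<close>, since the corner point lies on the line
  \<open>x + y = 1/2\<close>.\<close>

lemma conic_branch_at_corner: "- 1 / (4 * ((1 + sqrt 5) / 4)) = conic_branch ((1 + sqrt 5) / 4)"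
proof -
  define r :: real where "r = (1 + sqrt 5) / 4"
  have r: "1/2 < r" "r < 1" "r\<^sup>2 = r / 2 + 1 / 4"
    using corner_bounds corner_sq by (auto simp: r_def field_simps)
  then have "- 1 / (4 * r) = 1/2 - r"
    by (simp add: field_simps power2_eq_square)
  moreover have "1/2 - r = conic_branch r"
    using r by (subst conic_branch_eq_iff) (auto simp: power2_eq_square algebra_simps)
  ultimately show ?thesis
    by (simp add: r_def)
qed

lemma lower_boundary_nonpos:
  assumes "x \<in> {0..1}"
  shows "lower_boundary x \<le> 0"
  using assms conic_branch_nonpos[of x] by (auto simp: lower_boundary_def)

lemma lower_boundary_0 [simp]: "lower_boundary 0 = 0"
  by (simp add: lower_boundary_def)

lemma lower_boundary_1 [simp]: "lower_boundary 1 = 0"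
  using corner_bounds by (simp add: lower_boundary_def conic_branch_def)

text \<open>Neighbouring pieces agree where they meet: both give \<open>- 1/2\<close> at
  \<open>1/2\<close>, and at the corner \<open>conic_branch_at_corner\<close> applies.\<close>

lemma continuous_on_lower_boundary: "continuous_on {0..1} lower_boundary"
proof -
  obtain r :: real where r: "r = (1 + sqrt 5) / 4" "1/2 < r" "- 1 / (4 * r) = conic_branch r"
    using corner_bounds conic_branch_at_corner by metis
  have "continuous_on S conic_branch" for S
    unfolding conic_branch_def by (intro continuous_intros) auto
  then have "continuous_on {1/2..1} (\<lambda>x. if x \<le> r then - 1 / (4 * x) else conic_branch x)"
    using r by (intro continuous_on_cases_le) (auto intro!: continuous_intros)
  then have *: "continuous_on {x \<in> {0..1}. 1/2 \<le> x} (\<lambda>x. if x \<le> r then - 1 / (4 * x) else conic_branch x)"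
    by (rule continuous_on_subset) auto
  have "continuous_on {0..1} (\<lambda>x. if x \<le> 1/2 then - x else if x \<le> r then - 1 / (4 * x) else conic_branch x)"
  proof (rule continuous_on_cases_le)
    fix x :: real
    assume "x = 1/2"
    then show "- x = (if x \<le> r then - 1 / (4 * x) else conic_branch x)"
      unfolding \<open>x = 1/2\<close> using r by simp
  qed (rule * continuous_intros)+
  then show ?thesis
    unfolding r(1) lower_boundary_def[abs_def] .
qed

lemma boundary_curve_eq:
  "boundary_curve = (\<lambda>x. (x, lower_boundary x)) ` {0..1} \<union> (\<lambda>x. (x, x)) ` {0..1} \<union> {1} \<times> {0..1}"
proof -
  let ?r = "(1 + sqrt 5) / 4 :: real"
  note r = corner_bounds
  have C4: "(x, y) \<in> C4 \<longleftrightarrow> x \<in> {1/2..?r} \<and> y = - 1 / (4 * x)" for x y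
    by (auto simp: C4_def field_simps)
  have C5: "(x, y) \<in> C5 \<longleftrightarrow> x \<in> {?r..1} \<and> y = conic_branch x" for x y
  proof (cases "?r \<le> x")
    case True
    then have "0 \<le> x"
      using r by linarith
    with True show ?thesis
      using conic_branch_eq_iff[of x y] conic_branch_nonpos[of x] by (auto simp: C5_def)
  qed (auto simp: C5_def)
  have "(x, y) \<in> C2 \<union> C4 \<union> C5 \<longleftrightarrow> x \<in> {0..1} \<and> y = lower_boundary x" for x y
  proof -
    consider "x \<le> 1/2" | "1/2 < x" "x \<le> ?r" | "?r < x"
      by linarith
    then show ?thesis
    proof cases
      case 1
      then have "\<not> ?r \<le> x"
        using r by linarith
      moreover have "- 1 / (4 * x) = - x" if "1/2 \<le> x"
      proof -
        have "x = 1/2"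
          using 1 that by linarith
        show ?thesis
          unfolding \<open>x = 1/2\<close> by simp
      qed
      ultimately show ?thesis
        unfolding Un_iff C4 C5 using 1 by (auto simp: lower_boundary_def C2_def)
    next
      case 2
      have "conic_branch x = - 1 / (4 * x)" if "?r \<le> x"
      proof -
        have "x = ?r"
          using 2 that by linarith
        then show ?thesis
          using conic_branch_at_corner by metis
      qed
      with 2 show ?thesis
        unfolding Un_iff C4 C5 using r
        by (auto simp: lower_boundary_def C2_def)
    next
      case 3
      then have "1/2 < x"
        using r by linarith
      with 3 show ?thesis
        unfolding Un_iff C4 C5 by (auto simp: lower_boundary_def C2_def)
    qed
  qed
  then have "C2 \<union> C4 \<union> C5 = {(x, y). x \<in> {0..1} \<and> y = lower_boundary x}"
    by (simp add: set_eq_iff)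
  also have "\<dots> = (\<lambda>x. (x, lower_boundary x)) ` {0..1}"
    by auto
  finally have "C2 \<union> C4 \<union> C5 = (\<lambda>x. (x, lower_boundary x)) ` {0..1}" .
  moreover have "C1 = (\<lambda>x. (x, x)) ` {0..1}" "C3 = {1} \<times> {0..1}"
    by (auto simp: C1_def C3_def)
  ultimately show ?thesis
    unfolding boundary_curve_def by blast
qed

text \<open>The loop runs along the lower graph, up the side \<open>x = 1\<close> and back down the
  diagonal. As the lower graph never rises above 0, it meets the rest only at \<open>(0, 0)\<close>
  and \<open>(1, 0)\<close>.\<close>

lemma simple_closed_boundary_curve:
  "\<exists>g. simple_path g \<and> pathfinish g = pathstart g \<and> path_image g = boundary_curve"
proof -
  define lo where "lo = (\<lambda>x. (x, lower_boundary x))"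
  define ri where "ri = linepath (1 :: real, 0 :: real) (1, 1)"
  define di where "di = reversepath (\<lambda>x::real. (x, x))"
  have im: "path_image lo = (\<lambda>x. (x, lower_boundary x)) ` {0..1}"
       "path_image ri = {1} \<times> {0..1}" "path_image di = (\<lambda>x. (x, x)) ` {0..1}"
    unfolding lo_def ri_def di_def
    by (simp_all add: path_image_def[of "\<lambda>x. (x, _ x)"] closed_segment_same_fst closed_segment_eq_real_ivl)
  have ends: "pathstart lo = (0, 0)" "pathfinish lo = (1, 0)" "pathstart ri = (1, 0)"
       "pathfinish ri = (1, 1)" "pathstart di = (1, 1)" "pathfinish di = (0, 0)"
    by (simp_all add: lo_def ri_def di_def) (simp_all add: pathstart_def pathfinish_def)
  have "arc lo"
    unfolding lo_def by (intro arc_graph continuous_on_lower_boundary)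
  moreover have rd: "arc (ri +++ di)"
  proof (rule arc_join)
    show "arc ri" "arc di"
      by (auto simp: ri_def di_def intro!: arc_reversepath arc_graph continuous_intros)
  qed (auto simp: im ends)
  moreover have "path_image lo \<inter> path_image (ri +++ di) \<subseteq> {(0, 0), (1, 0)}"
    using lower_boundary_nonpos by (force simp: path_image_join im ends)
  ultimately have "simple_path (lo +++ (ri +++ di))"
    by (intro simple_path_join_loop) (auto simp: ends)
  moreover have "path_image (lo +++ (ri +++ di)) = boundary_curve"
    by (auto simp: path_image_join ends im boundary_curve_eq)
  ultimately show ?thesis
    by (intro exI[of _ "lo +++ (ri +++ di)"]) (simp add: ends)
qed

section \<open>The enclosed region and its polynomial description\<close>

lemma boundary_curve_Un_inside:
  "boundary_curve \<union> inside boundary_curve = {(x, y). x \<in> {0..1} \<and> lower_boundary x \<le> y \<and> y \<le> x}"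
    (is "_ = ?R")
proof -
  let ?U = "{(x, y). x \<in> {0<..<1} \<and> lower_boundary x < y \<and> y < x}"
  have le: "lower_boundary x \<le> x" if "x \<in> {0..1}" for x
    using lower_boundary_nonpos[OF that] that by auto
  \<comment> \<open>The vertical slice of the region at \<open>x = 0\<close> is the origin alone,
    and at \<open>x = 1\<close> it is the segment \<open>C3\<close>.\<close>
  have B: "boundary_curve = ?R - ?U"
  proof (rule Set.set_eqI)
    fix p :: "real \<times> real"
    obtain x y where "p = (x, y)"
      by force
    then show "p \<in> boundary_curve \<longleftrightarrow> p \<in> ?R - ?U"
      using le[of x] by (cases "x = 0"; cases "x = 1") (auto simp: boundary_curve_eq)
  qed
  have "inside boundary_curve = ?U"
    by (intro inside_region_between_graphs[OF continuous_on_lower_boundary _ le B]) auto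
  then show ?thesis
    using B by auto
qed

text \<open>This restates the region through the trace \<open>s = x + y\<close> and the determinant
  \<open>p = x * y\<close>: the conic form is \<open>s * (s - 1) - p\<close>. For
  \<open>y < 0\<close> the constraint of the piece of \<open>lower_boundary\<close> above which the
  point lies implies all the others.\<close>

lemma region_iff:
  "x \<in> {0..1} \<and> lower_boundary x \<le> y \<and> y \<le> x \<longleftrightarrow>
     y \<le> x \<and> x \<le> 1 \<and> 0 \<le> x + y \<and> - 1 / 4 \<le> x * y \<and>
     (y < 0 \<and> 1 / 2 \<le> x + y \<longrightarrow> x\<^sup>2 + x * y + y\<^sup>2 - x - y \<le> 0)"
    (is "?L \<longleftrightarrow> ?R")
proof (cases "0 \<le> y")
  case True
  show ?thesis
  proof (cases "y \<le> x \<and> x \<le> 1")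
    case True
    with \<open>0 \<le> y\<close> have "- 1 / 4 \<le> x * y" "lower_boundary x \<le> 0"
      using mult_nonneg_nonneg[of x y] by (linarith, auto intro!: lower_boundary_nonpos)
    with True \<open>0 \<le> y\<close> show ?thesis
      by auto
  qed auto
next
  case y: False
  consider "x < 0 \<or> x > 1" | "0 \<le> x" "x \<le> 1/2" | "1/2 < x" "x \<le> (1 + sqrt 5) / 4"
    | "(1 + sqrt 5) / 4 < x" "x \<le> 1"
    by linarith
  then show ?thesis
  proof cases
    case 1
    with y show ?thesis by auto
  next
    case 2
    have "- 1 / 4 \<le> x * y" if "- x \<le> y"
    proof -
      have "x * (- x) \<le> x * y" "x * x \<le> 1/2 * (1/2)"
        using 2 that by (intro mult_left_mono mult_mono; simp)+
      then show ?thesis by simp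
    qed
    \<comment> \<open>Here \<open>y < 0\<close> forces \<open>x + y < 1/2\<close>, so the conic
      condition is vacuous.\<close>
    with 2 y show ?thesis
      by (auto simp: lower_boundary_def)
  next
    case 3
    then have "x < 1"
      using corner_bounds by linarith
    have lb: "lower_boundary x \<le> y \<longleftrightarrow> - 1 / 4 \<le> x * y"
      using 3 by (auto simp: lower_boundary_def field_simps)
    have "0 \<le> x + y" if "- 1 / 4 \<le> x * y"
    proof (rule ccontr)
      assume "\<not> 0 \<le> x + y"
      then have "x * y < x * (- x)"
        using 3 by (intro mult_strict_left_mono) auto
      moreover have "1/2 * (1/2) \<le> x * x"
        using 3 by (intro mult_mono) auto
      ultimately show False
        using that by simp
    qed
    moreover have "x\<^sup>2 + x * y + y\<^sup>2 - x - y \<le> 0" if "1 / 2 \<le> x + y"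
    proof -
      have c: "x\<^sup>2 - x / 2 - 1 / 4 \<le> 0"
      proof (cases "x = (1 + sqrt 5) / 4")
        case True
        show ?thesis
          unfolding True corner_sq by simp
      qed (use 3 corner_le_iff[of x] in linarith)
      have "x * (x - 1) \<le> 0"
        using 3 \<open>x < 1\<close> by (intro mult_nonneg_nonpos) auto
      \<comment> \<open>The conic form \<open>q(y)\<close> is convex in \<open>y\<close>, so on \<open>[1/2 - x, 0]\<close> it lies below its chord, whose
        end values are \<open>x\<^sup>2 - x/2 - 1/4\<close> and \<open>x(x - 1)\<close>.\<close>
      have "(x - 1/2) * (x\<^sup>2 + x * y + y\<^sup>2 - x - y) =
         (x - 1/2) * y * (x + y - 1/2) + (- y) * (x\<^sup>2 - x / 2 - 1 / 4) + (x + y - 1/2) * (x * (x - 1))"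
        by (simp add: power2_eq_square field_simps)
      moreover have "(x - 1/2) * y * (x + y - 1/2) \<le> 0"
        using 3 y that by (intro mult_nonpos_nonneg mult_nonneg_nonpos) auto
      moreover have "(- y) * (x\<^sup>2 - x / 2 - 1 / 4) \<le> 0"
        using y c by (intro mult_nonneg_nonpos) auto
      moreover have "(x + y - 1/2) * (x * (x - 1)) \<le> 0"
        using that \<open>x * (x - 1) \<le> 0\<close> by (intro mult_nonneg_nonpos[of _ "x * (x - 1)"]) linarith+
      ultimately have "(x - 1/2) * (x\<^sup>2 + x * y + y\<^sup>2 - x - y) \<le> 0"
        by linarith
      then show ?thesis
        using 3 by (simp add: mult_le_0_iff)
    qed
    ultimately show ?thesis
      using lb y 3 \<open>x < 1\<close> by auto
  next
    case 4
    have half: "1/2 < x"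
      using 4 corner_bounds by linarith
    have c: "0 \<le> x\<^sup>2 - x / 2 - 1 / 4"
      using 4 corner_le_iff[of x] half by auto
    have lb: "lower_boundary x \<le> y \<longleftrightarrow> x\<^sup>2 + x * y + y\<^sup>2 - x - y \<le> 0"
      using 4 half y conic_branch_le_iff[of x y] by (auto simp: lower_boundary_def)
    \<comment> \<open>Right of the corner, \<open>x + y < 1/2\<close> would give
      \<open>x * y < - 1/4\<close>. This also refutes the conic inequality, since
      \<open>s * (s - 1)\<close> has minimum \<open>- 1/4\<close>, at
      \<open>s = 1/2\<close>.\<close>
    have sum: "1/2 \<le> x + y" if "- 1 / 4 \<le> x * y \<or> x\<^sup>2 + x * y + y\<^sup>2 - x - y \<le> 0"
    proof (rule ccontr)
      assume *: "\<not> 1/2 \<le> x + y"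
      have "x * y < x * (1/2 - x)"
        using * half by (intro mult_strict_left_mono) auto
      then have p: "x * y < - 1/4"
        using c by (simp add: power2_eq_square algebra_simps)
      with that have "(x + y) * (x + y - 1) - x * y \<le> 0"
        by (simp add: power2_eq_square algebra_simps)
      moreover have "(x + y) * (x + y - 1) \<ge> - 1/4"
        using zero_le_power2[of "x + y - 1/2"] by (simp add: power2_eq_square algebra_simps)
      ultimately show False
        using p by linarith
    qed
    have "- 1/4 \<le> x * y" if "x\<^sup>2 + x * y + y\<^sup>2 - x - y \<le> 0"
    proof -
      have "(x + y) * (x + y - 1) \<ge> - 1/4"
        using zero_le_power2[of "x + y - 1/2"] by (simp add: power2_eq_square algebra_simps)
      moreover have "(x + y) * (x + y - 1) - x * y \<le> 0"
        using that by (simp add: power2_eq_square algebra_simps)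
      ultimately show ?thesis
        by linarith
    qed
    then show ?thesis
      using lb sum y 4 half by fastforce
  qed
qed

subsection \<open>Spectra of monotone matrices of size 3\<close>

lemma det_mat_3:
  fixes A :: "'a :: comm_ring_1 mat"
  assumes "A \<in> carrier_mat 3 3"
  shows "Determinant.det A =
    A $$ (0, 0) * (A $$ (1, 1) * A $$ (2, 2) - A $$ (1, 2) * A $$ (2, 1)) -
    A $$ (0, 1) * (A $$ (1, 0) * A $$ (2, 2) - A $$ (1, 2) * A $$ (2, 0)) +
    A $$ (0, 2) * (A $$ (1, 0) * A $$ (2, 1) - A $$ (1, 1) * A $$ (2, 0))"
proof -
  have det2: "Determinant.det B = B $$ (0, 0) * B $$ (1, 1) - B $$ (0, 1) * B $$ (1, 0)"
    if "B \<in> carrier_mat 2 2" for B :: "'a mat"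
    using that
    by (subst laplace_expansion_row[OF that, of 0])
      (auto simp: cofactor_def mat_delete_def det_single lessThan_Suc numeral_2_eq_2)
  show ?thesis
    using assms
    by (subst laplace_expansion_row[OF assms, of 0])
      (auto simp: cofactor_def mat_delete_def det2 lessThan_Suc numeral_3_eq_3 numeral_2_eq_2 algebra_simps)
qed

text \<open>The coefficients \<open>a\<close>, \<open>b\<close>, \<open>c\<close>, \<open>d\<close> are differences of tail sums of consecutive rows.\<close>

lemma char_poly_row_sums_1:
  fixes A :: "'a :: comm_ring_1 mat"
  assumes A: "A \<in> carrier_mat 3 3"
    and rows: "\<And>i. i < 3 \<Longrightarrow> A $$ (i, 0) + A $$ (i, 1) + A $$ (i, 2) = 1"
    and a: "a = A $$ (1, 1) + A $$ (1, 2) - A $$ (0, 1) - A $$ (0, 2)"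
    and b: "b = A $$ (1, 2) - A $$ (0, 2)"
    and c: "c = A $$ (2, 1) + A $$ (2, 2) - A $$ (1, 1) - A $$ (1, 2)"
    and d: "d = A $$ (2, 2) - A $$ (1, 2)"
  shows "char_poly A = [:- 1, 1:] * [:a * d - b * c, - (a + d), 1:]"
proof -
  \<comment> \<open>With the first column eliminated, the claim is a polynomial identity in the
    other six entries.\<close>
  have A0: "A $$ (i, 0) = 1 - A $$ (i, 1) - A $$ (i, 2)" if "i < 3" for i
    using rows[OF that] by (simp add: algebra_simps)
  have entry: "char_poly_matrix A $$ (i, j) = (if i = j then [:- A $$ (i, j), 1:] else [:- A $$ (i, j):])"
    if "i < 3" "j < 3" for i j
    using A that by (auto simp: char_poly_matrix_def)
  have "char_poly_matrix A \<in> carrier_mat 3 3"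
    using A by simp
  then show ?thesis
    unfolding char_poly_def
    by (subst det_mat_3) (simp_all add: entry A0 a b c d algebra_simps)
qed

text \<open>Vieta's formulas, using that a monic complex polynomial is the product of the linear
  factors of its roots.\<close>

lemma proots_quadratic_eq_iff:
  fixes s p x y :: complex
  shows "proots [:p, - s, 1:] = {#x, y#} \<longleftrightarrow> x + y = s \<and> x * y = p"
proof -
  have fact: "[:- x, 1:] * [:- y, 1:] = [:x * y, - (x + y), 1:]"
    by simp
  show ?thesis
  proof
    assume "proots [:p, - s, 1:] = {#x, y#}"
    then have "[:p, - s, 1:] = [:- x, 1:] * [:- y, 1:]"
      using complex_poly_decompose_multiset[of "[:p, - s, 1:]"] by simp
    then show "x + y = s \<and> x * y = p"
      unfolding fact by (auto simp: minus_equation_iff[of s] ac_simps)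
  next
    assume "x + y = s \<and> x * y = p"
    then have "[:p, - s, 1:] = [:- x, 1:] * [:- y, 1:]"
      unfolding fact by simp
    moreover have "proots ([:- x, 1:] * [:- y, 1:]) = {#x, y#}"
      by (subst proots_mult) auto
    ultimately show "proots [:p, - s, 1:] = {#x, y#}"
      by simp
  qed
qed

lemma eigenvalue_mset_eq_iff:
  assumes M: "stochastic_matrix 3 M"
    and a: "a = M $$ (1, 1) + M $$ (1, 2) - M $$ (0, 1) - M $$ (0, 2)"
    and b: "b = M $$ (1, 2) - M $$ (0, 2)"
    and c: "c = M $$ (2, 1) + M $$ (2, 2) - M $$ (1, 1) - M $$ (1, 2)"
    and d: "d = M $$ (2, 2) - M $$ (1, 2)"
  shows "eigenvalue_mset M = {#1, complex_of_real x, complex_of_real y#} \<longleftrightarrow>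
    x + y = a + d \<and> x * y = a * d - b * c"
proof -
  let ?M = "map_mat complex_of_real M"
  have cM: "M \<in> carrier_mat 3 3" and rows: "\<And>i. i < 3 \<Longrightarrow> M $$ (i, 0) + M $$ (i, 1) + M $$ (i, 2) = 1"
    using M by (auto simp: stochastic_matrix_def numeral_3_eq_3 numeral_2_eq_2)
  have "?M $$ (i, 0) + ?M $$ (i, 1) + ?M $$ (i, 2) = 1" if "i < 3" for i
    using rows[OF that] that cM by (simp flip: of_real_add)
  then have "char_poly ?M = [:- 1, 1:] *
      [:complex_of_real (a * d - b * c), - complex_of_real (a + d), 1:]"
    using cM by (subst char_poly_row_sums_1[where a = "of_real a" and b = "of_real b" and c = "of_real c" and d = "of_real d"])
      (auto simp: a b c d)
  then have "eigenvalue_mset M =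
      {#1#} + proots [:complex_of_real (a * d - b * c), - complex_of_real (a + d), 1:]"
    unfolding eigenvalue_mset_def by (simp only:) (subst proots_mult, auto)
  then have "eigenvalue_mset M = {#1, complex_of_real x, complex_of_real y#} \<longleftrightarrow>
      complex_of_real x + complex_of_real y = complex_of_real (a + d) \<and>
      complex_of_real x * complex_of_real y = complex_of_real (a * d - b * c)"
    by (simp add: proots_quadratic_eq_iff[symmetric] del: of_real_add of_real_diff of_real_mult)
  then show ?thesis
    by (simp only: of_real_add[symmetric] of_real_mult[symmetric] of_real_eq_iff)
qed

text \<open>Full row sums all equal 1, so only the tails from columns 1 and 2 count, and by
  transitivity consecutive rows suffice.\<close>

lemma monotone_matrix_3_iff:
  "monotone_matrix 3 M \<longleftrightarrow> stochastic_matrix 3 M \<and>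
     M $$ (0, 2) \<le> M $$ (1, 2) \<and> M $$ (1, 2) \<le> M $$ (2, 2) \<and>
     M $$ (0, 1) + M $$ (0, 2) \<le> M $$ (1, 1) + M $$ (1, 2) \<and>
     M $$ (1, 1) + M $$ (1, 2) \<le> M $$ (2, 1) + M $$ (2, 2)"
proof -
  have less3: "(\<forall>i<3. P i) \<longleftrightarrow> P 0 \<and> P 1 \<and> P 2" for P :: "nat \<Rightarrow> bool"
    by (auto simp: numeral_3_eq_3 numeral_2_eq_2 less_Suc_eq)
  have less2: "(\<forall>i<2. P i) \<longleftrightarrow> P 0 \<and> P 1" for P :: "nat \<Rightarrow> bool"
    by (auto simp: numeral_2_eq_2 less_Suc_eq)
  have sums: "(\<Sum>j = 0..<3. M $$ (i, j)) = M $$ (i, 0) + M $$ (i, 1) + M $$ (i, 2)"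
      "(\<Sum>j = 1..<3. M $$ (i, j)) = M $$ (i, 1) + M $$ (i, 2)"
      "(\<Sum>j = 2..<3. M $$ (i, j)) = M $$ (i, 2)" for i
    by (simp_all add: numeral_3_eq_3 numeral_2_eq_2)
  show ?thesis
    unfolding monotone_matrix_def stochastic_matrix_def less3 less2 sums by auto
qed

lemma xi3_iff:
  "(x, y) \<in> xi3 \<longleftrightarrow> y \<le> x \<and> (\<exists>a\<ge>0. \<exists>b\<ge>0. \<exists>c\<ge>0. \<exists>d\<ge>0.
     a + c \<le> 1 \<and> b + d \<le> 1 \<and> b + c \<le> 1 \<and> x + y = a + d \<and> x * y = a * d - b * c)"
    (is "_ \<longleftrightarrow> _ \<and> ?E")
proof
  assume "(x, y) \<in> xi3"
  then obtain M where M: "monotone_matrix 3 M" "y \<le> x"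
      and ev: "eigenvalue_mset M = {#1, complex_of_real x, complex_of_real y#}"
    unfolding xi3_def monotone_matrices_def by auto
  have st: "stochastic_matrix 3 M"
    using M by (simp add: monotone_matrix_def)
  have rows: "M $$ (i, 0) + M $$ (i, 1) + M $$ (i, 2) = 1" if "i < 3" for i
    using M that by (auto simp: monotone_matrix_def stochastic_matrix_def numeral_3_eq_3 numeral_2_eq_2)
  have nn: "0 \<le> M $$ (i, j)" if "i < 3" "j < 3" for i j
    using M that by (auto simp: monotone_matrix_def stochastic_matrix_def)
  define a b c d where abcd: "a = M $$ (1, 1) + M $$ (1, 2) - M $$ (0, 1) - M $$ (0, 2)"
    "b = M $$ (1, 2) - M $$ (0, 2)" "c = M $$ (2, 1) + M $$ (2, 2) - M $$ (1, 1) - M $$ (1, 2)"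
    "d = M $$ (2, 2) - M $$ (1, 2)"
  have "0 \<le> a" "0 \<le> b" "0 \<le> c" "0 \<le> d"
    using M by (auto simp: abcd monotone_matrix_3_iff)
  \<comment> \<open>The sums \<open>a + c\<close> and \<open>b + d\<close> telescope. In
    \<open>b + c\<close> the entry \<open>M $$ (1, 2)\<close> cancels, leaving at most
    \<open>M $$ (2, 1) + M $$ (2, 2)\<close>.\<close>
  moreover have "a + c \<le> 1" "b + d \<le> 1" "b + c \<le> 1"
    using rows[of 0] rows[of 1] rows[of 2] nn[of 0 1] nn[of 0 2] nn[of 1 1] nn[of 2 0] nn[of 2 1]
    unfolding abcd by auto
  moreover have "x + y = a + d" "x * y = a * d - b * c"
    using ev eigenvalue_mset_eq_iff[OF st abcd] by auto
  ultimately have ?E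
    by blast
  with M show "y \<le> x \<and> ?E"
    by simp
next
  assume "y \<le> x \<and> ?E"
  then obtain a b c d where nn: "0 \<le> a" "0 \<le> b" "0 \<le> c" "0 \<le> d"
    and le: "a + c \<le> 1" "b + d \<le> 1" "b + c \<le> 1"
    and xy: "y \<le> x" "x + y = a + d" "x * y = a * d - b * c"
    by blast
  \<comment> \<open>The least middle entry of row 0 that keeps the middle entries of all rows of \<open>M\<close> nonnegative.\<close>
  define u where "u = max 0 (max (b - a) (b + d - a - c))"
  \<comment> \<open>For the three candidates in the maximum, \<open>u + a + c \<le> 1\<close> reads
    \<open>a + c \<le> 1\<close>, \<open>b + c \<le> 1\<close> and \<open>b + d \<le> 1\<close>:
    exactly the assumed bounds.\<close>
  have u: "0 \<le> u" "b - a \<le> u" "b + d - a - c \<le> u" "u + a + c \<le> 1"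
    using nn le unfolding u_def by auto
  \<comment> \<open>The tail sums are \<open>u\<close>, \<open>u + a\<close>,
    \<open>u + a + c\<close> from the middle column and \<open>0\<close>, \<open>b\<close>,
    \<open>b + d\<close> from the last, so their increments are as prescribed.\<close>
  define M where "M = mat_of_rows_list 3
    [[1 - u, u, 0], [1 - u - a, u + a - b, b], [1 - u - a - c, u + a + c - b - d, b + d]]"
  have less3: "(\<forall>i<3. P i) \<longleftrightarrow> P 0 \<and> P 1 \<and> P 2" for P :: "nat \<Rightarrow> bool"
    by (auto simp: numeral_3_eq_3 numeral_2_eq_2 less_Suc_eq)
  have "M $$ (0, 0) = 1 - u" "M $$ (0, 1) = u" "M $$ (0, 2) = 0"
    "M $$ (1, 0) = 1 - u - a" "M $$ (1, 1) = u + a - b" "M $$ (1, 2) = b"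
    "M $$ (2, 0) = 1 - u - a - c" "M $$ (2, 1) = u + a + c - b - d" "M $$ (2, 2) = b + d"
    by (simp_all add: M_def mat_of_rows_list_def)
  note entries = this this[unfolded One_nat_def]
  have "M \<in> carrier_mat 3 3"
    by (simp add: M_def mat_of_rows_list_def numeral_3_eq_3)
  moreover have "(\<Sum>j = 0..<3. M $$ (i, j)) = M $$ (i, 0) + M $$ (i, 1) + M $$ (i, 2)" for i
    by (simp add: numeral_3_eq_3 numeral_2_eq_2)
  ultimately have st: "stochastic_matrix 3 M"
    unfolding stochastic_matrix_def less3 using u nn le by (simp add: entries)
  have "monotone_matrix 3 M"
    unfolding monotone_matrix_3_iff using st nn by (simp add: entries)
  moreover have "eigenvalue_mset M = {#1, complex_of_real x, complex_of_real y#}"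
    using xy unfolding eigenvalue_mset_eq_iff[OF st refl refl refl refl] by (simp add: entries)
  ultimately show "(x, y) \<in> xi3"
    using xy unfolding xi3_def monotone_matrices_def by auto
qed

section \<open>Attainable traces and determinants compared with the region\<close>

text \<open>If \<open>a \<ge> 1/2\<close>, then \<open>c \<le> 1 - a \<le> 1/2\<close>, and
  \<open>z * (1 - z)\<close> increases up to \<open>1/2\<close>, so
  \<open>b * c \<le> a * (1 - a)\<close>; \<open>d \<ge> 1/2\<close> is symmetric with
  \<open>b\<close>. Otherwise \<open>b * c \<le> 1/4\<close> is enough. Equality holds for
  \<open>a = b = t\<close>, \<open>c = 1 - t\<close>, \<open>d = 0\<close>, where \<open>t\<close>
  is the trace.\<close>

lemma neg_det_le_trace_mult:
  fixes a b c d :: real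
  assumes nn: "0 \<le> a" "0 \<le> b" "0 \<le> c" "0 \<le> d" and le: "a + c \<le> 1" "b + d \<le> 1" "b + c \<le> 1"
    and t: "1/2 \<le> a + d" "a + d \<le> 1"
  shows "b * c - a * d \<le> (a + d) * (1 - (a + d))"
proof -
  have bc: "b * c \<le> 1/4"
  proof -
    have "0 \<le> (b - c)\<^sup>2" "(b + c)\<^sup>2 \<le> 1"
      using nn le by (auto intro!: power_le_one)
    then show ?thesis
      by (simp add: power2_eq_square algebra_simps)
  qed
  consider "1/2 \<le> a" | "1/2 \<le> d" | "a \<le> 1/2" "d \<le> 1/2"
    by linarith
  then show ?thesis
  proof cases
    case 1
    have "b * c \<le> (1 - c) * c"
      using nn le by (intro mult_right_mono) auto
    also have "\<dots> \<le> a * (1 - a)"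
    proof -
      have "0 \<le> (a - c) * (1 - a - c)"
        using 1 le by (intro mult_nonneg_nonneg) auto
      then show ?thesis
        by (simp add: algebra_simps)
    qed
    finally show ?thesis
      using mult_nonneg_nonneg[of d "1 - (a + d)"] nn t by (simp add: algebra_simps)
  next
    case 2
    have "b * c \<le> b * (1 - b)"
      using nn le by (intro mult_left_mono) auto
    also have "\<dots> \<le> d * (1 - d)"
    proof -
      have "0 \<le> (d - b) * (1 - d - b)"
        using 2 le by (intro mult_nonneg_nonneg) auto
      then show ?thesis
        by (simp add: algebra_simps)
    qed
    finally show ?thesis
      using mult_nonneg_nonneg[of a "1 - (a + d)"] nn t by (simp add: algebra_simps)
  next
    case 3
    \<comment> \<open>The sum of these two products is
      \<open>a * d + (a + d) * (1 - (a + d)) - 1/4\<close>.\<close>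
    have "0 \<le> (1/2 - a) * (1/2 - d)" "0 \<le> (a + d - 1/2) * (1 - (a + d))"
      using 3 t by (auto intro!: mult_nonneg_nonneg)
    then show ?thesis
      using bc by (simp add: field_simps)
  qed
qed

lemma xi3_eq_region: "(x, y) \<in> xi3 \<longleftrightarrow> x \<in> {0..1} \<and> lower_boundary x \<le> y \<and> y \<le> x"
  unfolding xi3_iff region_iff
proof (intro iffI; elim conjE exE)
  fix a b c d :: real
  assume nn: "0 \<le> a" "0 \<le> b" "0 \<le> c" "0 \<le> d"
    and le: "a + c \<le> 1" "b + d \<le> 1" "b + c \<le> 1"
    and xy: "y \<le> x" "x + y = a + d" "x * y = a * d - b * c"
  have "x \<le> 1"
  proof (rule ccontr)
    assume "\<not> x \<le> 1"
    \<comment> \<open>This says that the characteristic polynomial of the 2 by 2 block is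
      nonnegative at 1. If \<open>x > 1\<close>, then also \<open>y \<ge> 1\<close>, and the trace
      exceeds 2.\<close>
    have "b * c \<le> (1 - d) * (1 - a)"
      using nn le by (intro mult_mono) auto
    then have "0 \<le> (1 - x) * (1 - y)"
      using xy by (simp add: algebra_simps)
    then have "1 \<le> y"
      using \<open>\<not> x \<le> 1\<close> by (auto simp: zero_le_mult_iff)
    with \<open>\<not> x \<le> 1\<close> show False
      using xy nn le by linarith
  qed
  moreover have "- 1 / 4 \<le> x * y"
  proof -
    have "0 \<le> (b - c)\<^sup>2" "(b + c)\<^sup>2 \<le> 1" "0 \<le> a * d"
      using nn le by (auto intro!: power_le_one)
    then show ?thesis
      using xy(3) by (simp add: power2_eq_square algebra_simps)
  qed
  moreover have "x\<^sup>2 + x * y + y\<^sup>2 - x - y \<le> 0" if "y < 0" "1 / 2 \<le> x + y"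
  proof -
    have "a + d \<le> 1"
      using that xy \<open>x \<le> 1\<close> by linarith
    then have "- (x * y) \<le> (x + y) * (1 - (x + y))"
      using neg_det_le_trace_mult[OF nn le] that xy by simp
    then show ?thesis
      by (simp add: power2_eq_square algebra_simps)
  qed
  ultimately show "y \<le> x \<and> x \<le> 1 \<and> 0 \<le> x + y \<and> - 1 / 4 \<le> x * y \<and>
      (y < 0 \<and> 1 / 2 \<le> x + y \<longrightarrow> x\<^sup>2 + x * y + y\<^sup>2 - x - y \<le> 0)"
    using nn xy by auto
next
  assume xy: "y \<le> x" "x \<le> 1" "0 \<le> x + y" "- 1 / 4 \<le> x * y"
    and conic: "y < 0 \<and> 1 / 2 \<le> x + y \<longrightarrow> x\<^sup>2 + x * y + y\<^sup>2 - x - y \<le> 0"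
  let ?P = "\<lambda>a b c d. 0 \<le> a \<and> 0 \<le> b \<and> 0 \<le> c \<and> 0 \<le> d \<and> a + c \<le> 1 \<and> b + d \<le> 1 \<and> b + c \<le> 1 \<and>
    x + y = a + d \<and> x * y = a * d - b * c"
  have "\<exists>a b c d. ?P a b c d"
  proof -
    consider "0 \<le> y" | "y < 0" "x + y < 1/2" | "y < 0" "1/2 \<le> x + y"
      by linarith
    then show ?thesis
    proof cases
      case 1
      then have "?P x 0 0 y"
        using xy by auto
      then show ?thesis by blast
    next
      case 2
      \<comment> \<open>With \<open>d = 0\<close> the determinant is \<open>- b * c\<close>; equal
        factors \<open>b = c = s\<close> stay at most \<open>1/2\<close> by
        \<open>x * y \<ge> - 1/4\<close>.\<close>
      define s where "s = sqrt (- (x * y))"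
      have neg: "x * y \<le> 0"
        using 2 xy by (intro mult_nonneg_nonpos) auto
      have "s \<le> sqrt ((1/2)\<^sup>2)"
        unfolding s_def using xy by (intro real_sqrt_le_mono) (simp add: power2_eq_square)
      then have "?P (x + y) s s 0"
        using 2 xy neg by (auto simp: s_def)
      then show ?thesis by blast
    next
      case 3
      define t where "t = x + y"
      have t: "1/2 \<le> t" "t < 1"
        using 3 xy by (auto simp: t_def)
      have neg: "x * y \<le> 0"
        using 3 xy by (intro mult_nonneg_nonpos) auto
      have "- (x * y) \<le> t * (1 - t)"
        using conic 3 by (simp add: t_def power2_eq_square algebra_simps)
      \<comment> \<open>With \<open>a = t\<close> and \<open>d = 0\<close>, the largest admissible
        \<open>c\<close> is \<open>1 - t\<close>, and the determinant then fixes \<open>b\<close>.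
        The conic inequality gives \<open>b \<le> t\<close>, that is,
        \<open>b + c \<le> 1\<close>.\<close>
      moreover define b where "b = - (x * y) / (1 - t)"
      ultimately have "b \<le> t"
        using t by (simp only: pos_divide_le_eq)
      moreover have "0 \<le> b" "b * (1 - t) = - (x * y)"
        using t neg by (auto simp: b_def intro!: divide_nonpos_pos)
      ultimately have "?P t b (1 - t) 0"
        using t by (auto simp: t_def)
      then show ?thesis by blast
    qed
  qed
  with xy show "y \<le> x \<and> (\<exists>a\<ge>0. \<exists>b\<ge>0. \<exists>c\<ge>0. \<exists>d\<ge>0. a + c \<le> 1 \<and> b + d \<le> 1 \<and> b + c \<le> 1 \<and>
      x + y = a + d \<and> x * y = a * d - b * c)"
    by blast
qed

theorem theorem4p4:
  shows "(\<exists>g :: real \<Rightarrow> real \<times> real.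
            simple_path g \<and> pathfinish g = pathstart g \<and> path_image g = boundary_curve) \<and>
         xi3 = boundary_curve \<union> inside boundary_curve"
  using simple_closed_boundary_curve xi3_eq_region
  unfolding boundary_curve_Un_inside by auto

end
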